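(* Let $D=\{(1,0),(0,1),(-1,0),(0,-1)\}\subseteq\mathbb{Z}^2$, regarded as a digital image with basepoint $(1,0)$. Then $\pi_1\big(D;(1,0)\big)\cong\mathbb{Z}$.
   Context: A digital image is a finite subset $Y \subseteq \mathbb{Z}^n$ with adjacency relation $x \sim_Y y$ iff $|x_i - y_i| \le 1$ for every $i=1,\dots,n$. A function of digital images is continuous if it sends adjacent points to adjacent points. $I_N = \{0,1,\dots,N\}\subseteq\mathbb{Z}$, and $I_M\times I_R \subseteq \mathbb{Z}^2$ has $(s,t)\sim(s',t')$ iff $|s-s'|\le 1$ and $|t-t'|\le 1$. For a digital image $Y$ with basepoint $y_0\in Y$, a based loop of length $N\ge 1$ is a continuous $\gamma\colon I_N\to Y$ with $\gamma(0)=\gamma(N)=y_0$. Based loops $\alpha,\beta\colon I_M\to Y$ are based homotopic as based loops, $\alpha\approx\beta$, if for some $R\ge1$ there is a continuous $H\colon I_M\times I_R\to Y$ with $H(s,0)=\alpha(s)$, $H(s,R)=\beta(s)$ and $H(0,t)=H(M,t)=y_0$ for all $s,t$. For $k\ge1$, $\rho_k\colon I_{kN+k-1}\to I_N$ is $\rho_k(s)=\lfloor s/k\rfloor$. Based loops $\alpha\colon I_M\to Y$, $\beta\colon I_N\to Y$ are subdivision-based homotopic as based loops if for some $k,l\ge1$ with $k(M+1)=l(N+1)$ we have $\alpha\circ\rho_k\approx\beta\circ\rho_l$ as based loops. This is an equivalence relation; $[\alpha]$ is the class of $\alpha$ and $\pi_1(Y;y_0)$ the set of classes. It is a group under $[\alpha]\cdot[\beta]=[\alpha\cdot\beta]$,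 where $\alpha\cdot\beta\colon I_{M+N+1}\to Y$ is $\alpha(t)$ for $0\le t\le M$ and $\beta(t-(M+1))$ for $M+1\le t\le M+N+1$. *)

theory Defs
  imports "HOL-Analysis.Cartesian_Space" "HOL-Algebra.Elementary_Groups" "HOL-Library.FuncSet"
begin

text \<open>
  A digital image is a finite set \<open>Y :: (int ^ 'n) set\<close>. The domains of loops and of homotopies are
  the digital images \<open>Itv N\<close> and \<open>Itv M \<times> Itv R\<close>, placed in the types \<open>int\<close> and \<open>int \<times> int\<close>, with the
  corresponding adjacency relations.
\<close>

definition adj :: "int ^ 'n \<Rightarrow> int ^ 'n \<Rightarrow> bool" where
  "adj x y \<longleftrightarrow> (\<forall>i. \<bar>x $ i - y $ i\<bar> \<le> 1)"

definition adj1 :: "int \<Rightarrow> int \<Rightarrow> bool" where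
  "adj1 s s' \<longleftrightarrow> \<bar>s - s'\<bar> \<le> 1"

definition adj2 :: "int \<times> int \<Rightarrow> int \<times> int \<Rightarrow> bool" where
  "adj2 p q \<longleftrightarrow> adj1 (fst p) (fst q) \<and> adj1 (snd p) (snd q)"

definition digital_continuous ::
    "('a \<Rightarrow> 'a \<Rightarrow> bool) \<Rightarrow> 'a set \<Rightarrow> ('b \<Rightarrow> 'b \<Rightarrow> bool) \<Rightarrow> 'b set \<Rightarrow> ('a \<Rightarrow> 'b) \<Rightarrow> bool" where
  "digital_continuous adjX X adjY Y f \<longleftrightarrow>
     f \<in> X \<rightarrow> Y \<and> (\<forall>x\<in>X. \<forall>x'\<in>X. adjX x x' \<longrightarrow> adjY (f x) (f x'))"

definition Itv :: "int \<Rightarrow> int set" where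
  "Itv N = {0..N}"

text \<open>
  A loop is stored together with its length \<open>N\<close>; the function is \<^const>\<open>undefined\<close> outside \<open>Itv N\<close>, so
  that equality of pairs is equality of loops.
\<close>

type_synonym 'n loop = "int \<times> (int \<Rightarrow> int ^ 'n)"

definition based_loops :: "(int ^ 'n) set \<Rightarrow> int ^ 'n \<Rightarrow> 'n loop set" where
  "based_loops Y y0 =
     {(N, \<gamma>). N \<ge> 1 \<and> \<gamma> \<in> extensional (Itv N) \<and> digital_continuous adj1 (Itv N) adj Y \<gamma>
        \<and> \<gamma> 0 = y0 \<and> \<gamma> N = y0}"

definition based_homotopic ::
    "(int ^ 'n) set \<Rightarrow> int ^ 'n \<Rightarrow> int \<Rightarrow> (int \<Rightarrow> int ^ 'n) \<Rightarrow> (int \<Rightarrow> int ^ 'n) \<Rightarrow> bool" where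
  "based_homotopic Y y0 M \<alpha> \<beta> \<longleftrightarrow>
     (\<exists>R\<ge>1. \<exists>H. digital_continuous adj2 (Itv M \<times> Itv R) adj Y H
        \<and> (\<forall>s\<in>Itv M. H (s, 0) = \<alpha> s \<and> H (s, R) = \<beta> s)
        \<and> (\<forall>t\<in>Itv R. H (0, t) = y0 \<and> H (M, t) = y0))"

definition rho :: "int \<Rightarrow> int \<Rightarrow> int" where
  "rho k s = \<lfloor>real_of_int s / real_of_int k\<rfloor>"

definition subdivision_homotopic :: "(int ^ 'n) set \<Rightarrow> int ^ 'n \<Rightarrow> ('n loop \<times> 'n loop) set" where
  "subdivision_homotopic Y y0 =
     {((M, \<alpha>), (N, \<beta>)). (M, \<alpha>) \<in> based_loops Y y0 \<and> (N, \<beta>) \<in> based_loops Y y0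
        \<and> (\<exists>k\<ge>1. \<exists>l\<ge>1. k * (M + 1) = l * (N + 1)
             \<and> based_homotopic Y y0 (k * M + k - 1)
                 (compose (Itv (k * M + k - 1)) \<alpha> (rho k))
                 (compose (Itv (l * N + l - 1)) \<beta> (rho l)))}"

definition loop_class :: "(int ^ 'n) set \<Rightarrow> int ^ 'n \<Rightarrow> 'n loop \<Rightarrow> 'n loop set" where
  "loop_class Y y0 \<alpha> = subdivision_homotopic Y y0 `` {\<alpha>}"

fun loop_mult :: "'n loop \<Rightarrow> 'n loop \<Rightarrow> 'n loop" where
  "loop_mult (M, \<alpha>) (N, \<beta>) =
     (M + N + 1, \<lambda>t\<in>Itv (M + N + 1). if t \<le> M then \<alpha> t else \<beta> (t - (M + 1)))"

text \<open>
  The product of two classes is the union of the classes \<open>[\<alpha> \<cdot> \<beta>]\<close> over all representatives, which is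
  the common class \<open>[\<alpha> \<cdot> \<beta>]\<close> exactly when the product is independent of the representatives. The unit
  is the class of the constant loop.
\<close>

definition digital_pi1 :: "(int ^ 'n) set \<Rightarrow> int ^ 'n \<Rightarrow> 'n loop set monoid" where
  "digital_pi1 Y y0 =
     \<lparr>carrier = based_loops Y y0 // subdivision_homotopic Y y0,
      monoid.mult = (\<lambda>A B. \<Union>\<alpha>\<in>A. \<Union>\<beta>\<in>B. loop_class Y y0 (loop_mult \<alpha> \<beta>)),
      one = loop_class Y y0 (1, \<lambda>s\<in>Itv 1. y0)\<rparr>"

definition diamond :: "(int ^ 2) set" where
  "diamond = {vector [1, 0], vector [0, 1], vector [-1, 0], vector [0, -1]}"

end

theory Submission imports Defs begin

text \<open>
  The diamond is a digital 4-cycle, and it is covered by the digital line: going round the cycle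
  gives \<open>wrap :: int \<Rightarrow> int ^ 2\<close>, constant on residue classes modulo 4. The signed step of this covering
  between two adjacent points is their determinant \<open>turn x y\<close>, so the lift of a loop is the running sum
  of its turns, and a loop has a degree, the end point of its lift, which is a multiple of 4.
  
  The degree is a complete invariant of subdivision-based homotopy
  (\<open>subdivision_homotopic_diamond\<close>). It is invariant because pairwise adjacent points of the diamond
  never go round the cycle: at most two of them are distinct, so \<open>turn\<close> is additive on them
  (\<open>turn_triangle\<close>), and the sums along neighbouring rows of a homotopy differ only by the turns along
  the two sides, where the homotopy rests at the base point.
  
  It separates classes because lifts with common end points can be deformed into each other in the
  line. The obvious deformation along straight segments needs room: adjacency in the domain includes
  diagonals, so a row that moves by 1 at every step cannot change at all. Subdivision provides the room.
  The lifts of the subdivided loops are replaced by piecewise linear real functions of slope at most \<open>1/2\<close>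
  (\<open>smoothing_homotopic\<close>), a slow straight-line homotopy joins these (\<open>straight_line_homotopic\<close>), and
  taking floors returns to the integers, since the floors of reals at distance at most 1 are adjacent.
  
  Finally the degree is additive on products and takes all values in \<open>4\<int>\<close>, so the classes are the sets of
  loops of degree \<open>4 * n\<close>, and \<open>n\<close> enumerates them as a group.
\<close>

section \<open>The covering of the diamond by the integers\<close>

definition wrap :: "int \<Rightarrow> int ^ 2" where
  "wrap n = (if n mod 4 = 0 then vector [1, 0] else if n mod 4 = 1 then vector [0, 1]
     else if n mod 4 = 2 then vector [-1, 0] else vector [0, -1])"

text \<open>
  The determinant of two vectors. On adjacent points of the diamond it is 1, 0 or \<open>-1\<close> according to
  whether the second point is the anticlockwise neighbour of the first, equal to it, or its clockwise
  neighbour.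
\<close>

definition turn :: "int ^ 2 \<Rightarrow> int ^ 2 \<Rightarrow> int" where
  "turn x y = x $ 1 * y $ 2 - x $ 2 * y $ 1"

lemma turn_self [simp]: "turn x x = 0"
  by (simp add: turn_def)

lemma diamond_coordinates:
  assumes "x \<in> diamond"
  obtains "x $ 1 = 1" "x $ 2 = 0" | "x $ 1 = 0" "x $ 2 = 1"
  | "x $ 1 = - 1" "x $ 2 = 0" | "x $ 1 = 0" "x $ 2 = - 1"
  using assms by (auto simp: diamond_def)

lemma turn_bounded: "x \<in> diamond \<Longrightarrow> y \<in> diamond \<Longrightarrow> \<bar>turn x y\<bar> \<le> 1"
  by (elim diamond_coordinates) (simp_all add: turn_def)

text \<open>
  The local reason for homotopy invariance: the 4-cycle contains no triangles, so two of the
  three points coincide, and \<open>turn\<close> is antisymmetric.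
\<close>

lemma turn_triangle:
  assumes "x \<in> diamond" "y \<in> diamond" "z \<in> diamond" "adj x y" "adj y z" "adj x z"
  shows "turn x y + turn y z = turn x z"
proof -
  have "\<bar>x $ 1 - y $ 1\<bar> \<le> 1" "\<bar>y $ 1 - z $ 1\<bar> \<le> 1" "\<bar>x $ 1 - z $ 1\<bar> \<le> 1"
    "\<bar>x $ 2 - y $ 2\<bar> \<le> 1" "\<bar>y $ 2 - z $ 2\<bar> \<le> 1" "\<bar>x $ 2 - z $ 2\<bar> \<le> 1"
    using assms(4-6) by (auto simp: adj_def)
  with assms(1-3) show ?thesis
    unfolding turn_def by (elim diamond_coordinates) simp_all
qed

lemma wrap_in_diamond [simp]: "wrap n \<in> diamond"
  by (simp add: wrap_def diamond_def)

lemma wrap_eq_base_iff: "wrap n = vector [1, 0] \<longleftrightarrow> 4 dvd n"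
  by (auto simp: wrap_def vec_eq_iff forall_2 dvd_eq_mod_eq_0)

lemma wrap_neighbours:
  obtains
    "wrap n = vector [1, 0]" "wrap (n + 1) = vector [0, 1]" "wrap (n - 1) = vector [0, -1]"
  | "wrap n = vector [0, 1]" "wrap (n + 1) = vector [-1, 0]" "wrap (n - 1) = vector [1, 0]"
  | "wrap n = vector [-1, 0]" "wrap (n + 1) = vector [0, -1]" "wrap (n - 1) = vector [0, 1]"
  | "wrap n = vector [0, -1]" "wrap (n + 1) = vector [1, 0]" "wrap (n - 1) = vector [-1, 0]"
proof -
  have up: "(n + 1) mod 4 = (n mod 4 + 1) mod 4" and down: "(n - 1) mod 4 = (n mod 4 - 1) mod 4"
    by (simp_all add: mod_add_left_eq mod_diff_left_eq)
  have "0 \<le> n mod 4" "n mod 4 < 4"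
    by simp_all
  then have "n mod 4 = 0 \<or> n mod 4 = 1 \<or> n mod 4 = 2 \<or> n mod 4 = 3"
    by linarith
  then consider (0) "n mod 4 = 0" | (1) "n mod 4 = 1" | (2) "n mod 4 = 2" | (3) "n mod 4 = 3"
    by blast
  then show thesis
  proof cases
    case 0 show ?thesis by (rule that(1); unfold wrap_def up down 0; simp)
  next
    case 1 show ?thesis by (rule that(2); unfold wrap_def up down 1; simp)
  next
    case 2 show ?thesis by (rule that(3); unfold wrap_def up down 2; simp)
  next
    case 3 show ?thesis by (rule that(4); unfold wrap_def up down 3; simp)
  qed
qed

lemma wrap_step:
  shows "adj (wrap n) (wrap (n + 1))" and "turn (wrap n) (wrap (n + 1)) = 1"
    and "turn (wrap (n + 1)) (wrap n) = - 1"
  by (rule wrap_neighbours[of n]; simp add: adj_def turn_def forall_2)+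

lemma adj_refl [simp]: "adj x x"
  by (simp add: adj_def)

lemma adj_sym: "adj x y \<Longrightarrow> adj y x"
  by (simp add: adj_def abs_minus_commute)

lemma wrap_near:
  assumes "\<bar>a - b\<bar> \<le> 1"
  shows "adj (wrap a) (wrap b)" and "turn (wrap a) (wrap b) = b - a"
proof -
  consider "b = a" | "b = a + 1" | "a = b + 1" using assms by linarith
  then have "adj (wrap a) (wrap b) \<and> turn (wrap a) (wrap b) = b - a"
    by cases (simp_all add: wrap_step adj_sym[OF wrap_step(1)])
  then show "adj (wrap a) (wrap b)" and "turn (wrap a) (wrap b) = b - a"
    by simp_all
qed

text \<open>
  Unique lifting of a single step: a point over \<open>x\<close> together with an adjacent \<open>y\<close> determines the
  point over \<open>y\<close>, and \<open>turn\<close> computes it.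
\<close>

lemma wrap_turn:
  assumes "y \<in> diamond" "adj (wrap a) y"
  shows "y = wrap (a + turn (wrap a) y)"
proof -
  consider "y = vector [1, 0]" | "y = vector [0, 1]" | "y = vector [-1, 0]" | "y = vector [0, -1]"
    using assms(1) by (auto simp: diamond_def)
  then show ?thesis
    by cases (rule wrap_neighbours[of a]; use assms(2) in \<open>simp add: adj_def turn_def forall_2\<close>)+
qed

section \<open>Lifts and degrees\<close>

definition lift :: "(int \<Rightarrow> int ^ 2) \<Rightarrow> int \<Rightarrow> int" where
  "lift \<gamma> s = (\<Sum>i\<in>{0..<s}. turn (\<gamma> i) (\<gamma> (i + 1)))"

lemma lift_0 [simp]: "s \<le> 0 \<Longrightarrow> lift \<gamma> s = 0"
  by (simp add: lift_def)

lemma lift_step: "0 \<le> s \<Longrightarrow> lift \<gamma> (s + 1) = lift \<gamma> s + turn (\<gamma> s) (\<gamma> (s + 1))"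
proof -
  assume "0 \<le> s"
  then have "{0..<s + 1} = insert s {0..<s}" by auto
  then show ?thesis by (simp add: lift_def)
qed

lemma lift_cong:
  assumes "\<And>s. 0 \<le> s \<Longrightarrow> s \<le> M \<Longrightarrow> \<alpha> s = \<beta> s"
  shows "lift \<alpha> M = lift \<beta> M"
  unfolding lift_def by (rule sum.cong) (auto simp: assms)

fun degree :: "2 loop \<Rightarrow> int" where
  "degree (M, \<gamma>) = lift \<gamma> M"

abbreviation diamond_loops :: "2 loop set" where
  "diamond_loops \<equiv> based_loops diamond (vector [1, 0])"

lemma based_loopsD:
  assumes "(M, \<gamma>) \<in> based_loops Y y0"
  shows "1 \<le> M" "\<gamma> 0 = y0" "\<gamma> M = y0"
    and "\<And>s. 0 \<le> s \<Longrightarrow> s \<le> M \<Longrightarrow> \<gamma> s \<in> Y"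
    and "\<And>s t. 0 \<le> s \<Longrightarrow> s \<le> M \<Longrightarrow> 0 \<le> t \<Longrightarrow> t \<le> M \<Longrightarrow> \<bar>s - t\<bar> \<le> 1 \<Longrightarrow> adj (\<gamma> s) (\<gamma> t)"
  using assms by (auto simp: based_loops_def digital_continuous_def Itv_def adj1_def Pi_iff)

text \<open>
  The running sum of turns is a lift through the covering, starting at 0 over the base point.
\<close>

lemma wrap_lift:
  assumes "(M, \<gamma>) \<in> diamond_loops" "0 \<le> s" "s \<le> M"
  shows "wrap (lift \<gamma> s) = \<gamma> s"
  using assms(2,3)
proof (induction s rule: int_ge_induct)
  case base
  then show ?case using based_loopsD(2)[OF assms(1)] by (simp add: wrap_def)
next
  case (step s)
  note L = based_loopsD[OF assms(1)]
  have "adj (wrap (lift \<gamma> s)) (\<gamma> (s + 1))"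
    using step L(5)[of s "s + 1"] by simp
  then have "wrap (lift \<gamma> s + turn (wrap (lift \<gamma> s)) (\<gamma> (s + 1))) = \<gamma> (s + 1)"
    using step L(4)[of "s + 1"] by (intro wrap_turn [symmetric]) auto
  then show ?case using step by (simp add: lift_step)
qed

text \<open>
  A lifted loop ends over the base point, whose fibre is \<open>4\<int>\<close>.
\<close>

lemma degree_dvd:
  assumes "a \<in> diamond_loops"
  shows "4 dvd degree a"
proof -
  obtain M \<gamma> where a: "a = (M, \<gamma>)" by (cases a)
  note \<gamma> = based_loopsD[OF assms[unfolded a]]
  have "wrap (lift \<gamma> M) = vector [1, 0]"
    using wrap_lift[OF assms[unfolded a], of M] \<gamma>(1,3) by simp
  then show ?thesis by (simp only: a degree.simps wrap_eq_base_iff)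
qed

lemma lift_wrap:
  assumes "\<And>s. 0 \<le> s \<Longrightarrow> s < M \<Longrightarrow> \<bar>h s - h (s + 1)\<bar> \<le> 1" "0 \<le> M"
  shows "lift (\<lambda>s. wrap (h s)) M = h M - h 0"
  using assms(2,1)
proof (induction M rule: int_ge_induct)
  case (step M)
  have "lift (\<lambda>s. wrap (h s)) M = h M - h 0"
    using step.prems by (intro step.IH) simp
  moreover have "turn (wrap (h M)) (wrap (h (M + 1))) = h (M + 1) - h M"
    using step.prems[of M] step.hyps by (intro wrap_near) simp
  ultimately show ?case using step.hyps by (simp add: lift_step)
qed simp

lemma rho_div: "rho k s = s div k"
  by (simp add: rho_def floor_divide_of_int_eq)

text \<open>
  A step of the subdivided interval either stays in its block of length \<open>k\<close> or passes from the last
  point of a block to the first point of the next one.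
\<close>

lemma div_step:
  fixes k s :: int
  assumes "k \<ge> 1"
  shows "((s + 1) div k = s div k \<and> (s + 1) mod k = s mod k + 1)
    \<or> ((s + 1) div k = s div k + 1 \<and> (s + 1) mod k = 0 \<and> s mod k = k - 1)"
proof (cases "s mod k = k - 1")
  case True
  then have "s + 1 = k * (s div k + 1)"
    by (simp add: algebra_simps minus_mod_eq_mult_div [symmetric])
  then show ?thesis using True assms by (metis mod_mult_self1_is_0 nonzero_mult_div_cancel_left not_one_le_zero)
next
  case False
  then have r: "0 \<le> s mod k + 1" "s mod k + 1 < k" using assms
    by (smt (verit) pos_mod_bound pos_mod_sign)+
  have "s + 1 = s mod k + 1 + k * (s div k)" by simp
  then have "(s + 1) div k = (s mod k + 1) div k + s div k" "(s + 1) mod k = (s mod k + 1) mod k"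
    using assms by (metis div_mult_self2 add.commute not_one_le_zero, metis mod_mult_self2)
  with r show ?thesis by simp
qed

text \<open>
  Subdividing a loop inserts only rests, which have turn 0.
\<close>

lemma lift_subdivide:
  assumes "k \<ge> 1" "0 \<le> s"
  shows "lift (\<lambda>s. \<gamma> (s div k)) s = lift \<gamma> (s div k)"
  using assms(2)
proof (induction s rule: int_ge_induct)
  case (step s)
  have "0 \<le> s div k" using step assms by (simp add: pos_imp_zdiv_nonneg_iff)
  then show ?case using div_step[OF assms(1), of s] step by (auto simp: lift_step)
qed simp

lemma div_Itv:
  fixes k s M :: int
  assumes "k \<ge> 1" "s \<in> Itv (k * M + k - 1)"
  shows "0 \<le> s div k" "s div k \<le> M"
proof -
  show "0 \<le> s div k" using assms by (simp add: Itv_def pos_imp_zdiv_nonneg_iff)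
  have "s < (M + 1) * k" using assms by (simp add: Itv_def algebra_simps)
  then have "s div k < M + 1"
    using assms(1) by (smt (verit) div_mult_mod_eq mult_le_cancel_right pos_mod_sign)
  then show "s div k \<le> M" by simp
qed

lemma div_last:
  fixes k M :: int
  assumes "k \<ge> 1"
  shows "(k * M + k - 1) div k = M" "(k * M + k - 1) mod k = k - 1"
proof -
  have "k * M + k - 1 = (k - 1) + k * M" by simp
  then have "(k * M + k - 1) div k = M + (k - 1) div k" "(k * M + k - 1) mod k = (k - 1) mod k"
    using assms by (simp_all only: div_mult_self2 mod_mult_self2)
  moreover have "(k - 1) div k = 0" "(k - 1) mod k = k - 1"
    by (rule div_pos_pos_trivial mod_pos_pos_trivial; use assms in simp)+
  ultimately show "(k * M + k - 1) div k = M" "(k * M + k - 1) mod k = k - 1"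
    by simp_all
qed

lemma lift_compose_rho:
  assumes "k \<ge> 1" "M \<ge> 0"
  shows "lift (compose (Itv (k * M + k - 1)) \<gamma> (rho k)) (k * M + k - 1) = lift \<gamma> M"
proof -
  have "0 \<le> k * M" using assms by simp
  then have "0 \<le> k * M + k - 1" using assms by linarith
  have "lift (compose (Itv (k * M + k - 1)) \<gamma> (rho k)) (k * M + k - 1)
      = lift (\<lambda>s. \<gamma> (s div k)) (k * M + k - 1)"
    by (rule lift_cong) (simp add: compose_def Itv_def rho_div)
  also have "\<dots> = lift \<gamma> M"
    using \<open>0 \<le> k * M + k - 1\<close> assms by (simp add: lift_subdivide div_last)
  finally show ?thesis .
qed

text \<open>
  Over each step of two consecutive rows of a homotopy lies a square of four pairwise adjacent points.
  Both paths along its sides from one corner to the opposite one have the same total turn, namely the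
  turn along the diagonal. The identity is what is left after telescoping these squares.
\<close>

lemma lift_adjacent_rows:
  assumes D: "\<And>s. 0 \<le> s \<Longrightarrow> s \<le> M \<Longrightarrow> a s \<in> diamond \<and> b s \<in> diamond"
    and A: "\<And>s t. 0 \<le> s \<Longrightarrow> s \<le> M \<Longrightarrow> 0 \<le> t \<Longrightarrow> t \<le> M \<Longrightarrow> \<bar>s - t\<bar> \<le> 1 \<Longrightarrow>
      adj (a s) (a t) \<and> adj (a s) (b t) \<and> adj (b s) (b t)"
    and "0 \<le> s" "s \<le> M"
  shows "lift a s + turn (a s) (b s) = turn (a 0) (b 0) + lift b s"
  using assms(3,4)
proof (induction s rule: int_ge_induct)
  case (step s)
  let ?a = "a s" and ?a' = "a (s + 1)" and ?b = "b s" and ?b' = "b (s + 1)"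
  have "turn ?a ?a' + turn ?a' ?b' = turn ?a ?b'"
    using step A[of s "s + 1"] A[of "s + 1" "s + 1"] by (intro turn_triangle) (auto simp: D)
  moreover have "turn ?a ?b + turn ?b ?b' = turn ?a ?b'"
    using step A[of s s] A[of s "s + 1"] by (intro turn_triangle) (auto simp: D)
  ultimately show ?case using step by (simp add: lift_step)
qed simp

lemma lift_homotopic:
  assumes "based_homotopic diamond y0 M \<alpha> \<beta>" "0 \<le> M"
  shows "lift \<alpha> M = lift \<beta> M"
proof -
  obtain R H where R: "1 \<le> R" and H: "digital_continuous adj2 (Itv M \<times> Itv R) adj diamond H"
    and rows: "\<forall>s\<in>Itv M. H (s, 0) = \<alpha> s \<and> H (s, R) = \<beta> s"
    and ends: "\<forall>t\<in>Itv R. H (0, t) = y0 \<and> H (M, t) = y0"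
    using assms unfolding based_homotopic_def by blast
  have HD: "H (s, t) \<in> diamond" if "0 \<le> s" "s \<le> M" "0 \<le> t" "t \<le> R" for s t
    using H that by (auto simp: digital_continuous_def Itv_def)
  have HA: "adj (H (s, t)) (H (s', t'))"
    if "0 \<le> s" "s \<le> M" "0 \<le> t" "t \<le> R" "0 \<le> s'" "s' \<le> M" "0 \<le> t'" "t' \<le> R" 
       "\<bar>s - s'\<bar> \<le> 1" "\<bar>t - t'\<bar> \<le> 1" for s t s' t'
    using H that by (auto simp: digital_continuous_def Itv_def adj2_def adj1_def)
  have "lift (\<lambda>s. H (s, t)) M = lift (\<lambda>s. H (s, 0)) M" if "0 \<le> t" "t \<le> R" for t
    using that
  proof (induction t rule: int_ge_induct)
    case (step t)
    have "lift (\<lambda>s. H (s, t)) M + turn (H (M, t)) (H (M, t + 1))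
        = turn (H (0, t)) (H (0, t + 1)) + lift (\<lambda>s. H (s, t + 1)) M"
      using step assms(2) by (intro lift_adjacent_rows[where M = M]) (auto simp: HD HA)
    then show ?case using step ends by (auto simp: Itv_def)
  qed simp
  from this[of R] R have "lift (\<lambda>s. H (s, R)) M = lift (\<lambda>s. H (s, 0)) M" by simp
  moreover have "lift (\<lambda>s. H (s, R)) M = lift \<beta> M" "lift (\<lambda>s. H (s, 0)) M = lift \<alpha> M"
    using rows by (auto simp: Itv_def intro!: lift_cong)
  ultimately show ?thesis by simp
qed

section \<open>Loops of equal degree are homotopic\<close>

lemma based_homotopic_sym:
  assumes "based_homotopic Y y0 M \<alpha> \<beta>"
  shows "based_homotopic Y y0 M \<beta> \<alpha>"
proof -
  obtain R H where *: "1 \<le> R" "digital_continuous adj2 (Itv M \<times> Itv R) adj Y H"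
    "\<forall>s\<in>Itv M. H (s, 0) = \<alpha> s \<and> H (s, R) = \<beta> s"
    "\<forall>t\<in>Itv R. H (0, t) = y0 \<and> H (M, t) = y0"
    using assms unfolding based_homotopic_def by blast
  show ?thesis unfolding based_homotopic_def
    using * by (intro exI[of _ R] conjI exI[of _ "\<lambda>(s, t). H (s, R - t)"])
      (auto simp: digital_continuous_def Itv_def adj2_def adj1_def Pi_iff)
qed

lemma based_homotopic_trans:
  assumes "based_homotopic Y y0 M \<alpha> \<beta>" "based_homotopic Y y0 M \<beta> \<gamma>"
  shows "based_homotopic Y y0 M \<alpha> \<gamma>"
proof -
  obtain R H where H: "1 \<le> R" "digital_continuous adj2 (Itv M \<times> Itv R) adj Y H"
    "\<forall>s\<in>Itv M. H (s, 0) = \<alpha> s \<and> H (s, R) = \<beta> s"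
    "\<forall>t\<in>Itv R. H (0, t) = y0 \<and> H (M, t) = y0"
    using assms(1) unfolding based_homotopic_def by blast
  obtain S K where K: "1 \<le> S" "digital_continuous adj2 (Itv M \<times> Itv S) adj Y K"
    "\<forall>s\<in>Itv M. K (s, 0) = \<beta> s \<and> K (s, S) = \<gamma> s"
    "\<forall>t\<in>Itv S. K (0, t) = y0 \<and> K (M, t) = y0"
    using assms(2) unfolding based_homotopic_def by blast
  let ?J = "\<lambda>(s, t). if t \<le> R then H (s, t) else K (s, t - R)"
  have late: "?J (s, t) = K (s, t - R)" if "s \<in> Itv M" "R \<le> t" for s t
    using that H(3) K(3) by auto
  have HD: "\<And>s t. s \<in> Itv M \<Longrightarrow> t \<in> Itv R \<Longrightarrow> H (s, t) \<in> Y"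
    and HA: "\<And>s t s' t'. s \<in> Itv M \<Longrightarrow> t \<in> Itv R \<Longrightarrow> s' \<in> Itv M \<Longrightarrow> t' \<in> Itv R \<Longrightarrow>
      adj2 (s, t) (s', t') \<Longrightarrow> adj (H (s, t)) (H (s', t'))"
    and KD: "\<And>s t. s \<in> Itv M \<Longrightarrow> t \<in> Itv S \<Longrightarrow> K (s, t) \<in> Y"
    and KA: "\<And>s t s' t'. s \<in> Itv M \<Longrightarrow> t \<in> Itv S \<Longrightarrow> s' \<in> Itv M \<Longrightarrow> t' \<in> Itv S \<Longrightarrow>
      adj2 (s, t) (s', t') \<Longrightarrow> adj (K (s, t)) (K (s', t'))"
    using H(2) K(2) by (auto simp: digital_continuous_def)
  have "?J (s, t) \<in> Y" if "s \<in> Itv M" "t \<in> Itv (R + S)" for s t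
    using that HD[of s t] KD[of s "t - R"] by (auto simp: Itv_def)
  moreover have "adj (?J (s, t)) (?J (s', t'))"
    if *: "s \<in> Itv M" "t \<in> Itv (R + S)" "s' \<in> Itv M" "t' \<in> Itv (R + S)" "adj2 (s, t) (s', t')"
    for s t s' t'
  proof (cases "t \<le> R \<and> t' \<le> R")
    case True
    then show ?thesis using * by (auto simp: Itv_def intro!: HA)
  next
    case False
    \<comment> \<open>Adjacent times never lie strictly on opposite sides of \<open>R\<close>.\<close>
    then have "R \<le> t" "R \<le> t'" using *(5) by (auto simp: adj2_def adj1_def)
    then have "adj (K (s, t - R)) (K (s', t' - R))"
      using * by (intro KA) (auto simp: Itv_def adj2_def adj1_def)
    then show ?thesis using late[OF *(1) \<open>R \<le> t\<close>] late[OF *(3) \<open>R \<le> t'\<close>] by (simp only:)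
  qed
  ultimately have "digital_continuous adj2 (Itv M \<times> Itv (R + S)) adj Y ?J"
    unfolding digital_continuous_def by blast
  moreover have "\<forall>s\<in>Itv M. ?J (s, 0) = \<alpha> s \<and> ?J (s, R + S) = \<gamma> s"
    using H K by (auto simp: Itv_def)
  moreover have "\<forall>t\<in>Itv (R + S). ?J (0, t) = y0 \<and> ?J (M, t) = y0"
    using H K by (auto simp: Itv_def)
  moreover have "1 \<le> R + S" using H K by simp
  ultimately show ?thesis unfolding based_homotopic_def by blast
qed

text \<open>
  Homotopies in the diamond come from real-valued functions that vary by at most 1 between neighbours,
  diagonal ones included: taking floors keeps neighbours adjacent, and \<open>wrap\<close> preserves adjacency.
\<close>

lemma wrap_floor_homotopic:
  fixes \<Phi> :: "int \<Rightarrow> int \<Rightarrow> real"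
  assumes R: "1 \<le> R" 
    and step: "\<And>s s' t t'. s \<in> Itv M \<Longrightarrow> s' \<in> Itv M \<Longrightarrow> t \<in> Itv R \<Longrightarrow> t' \<in> Itv R \<Longrightarrow> 
        \<bar>s - s'\<bar> \<le> 1 \<Longrightarrow> \<bar>t - t'\<bar> \<le> 1 \<Longrightarrow> \<bar>\<Phi> s t - \<Phi> s' t'\<bar> \<le> 1"
    and ends: "\<And>t. t \<in> Itv R \<Longrightarrow> \<Phi> 0 t = 0 \<and> \<Phi> M t = of_int c" and c: "4 dvd c"
    and \<alpha>: "\<And>s. s \<in> Itv M \<Longrightarrow> \<alpha> s = wrap \<lfloor>\<Phi> s 0\<rfloor>" and \<beta>: "\<And>s. s \<in> Itv M \<Longrightarrow> \<beta> s = wrap \<lfloor>\<Phi> s R\<rfloor>"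
  shows "based_homotopic diamond (vector [1, 0]) M \<alpha> \<beta>"
proof -
  have fl: "\<bar>\<lfloor>x\<rfloor> - \<lfloor>y\<rfloor>\<bar> \<le> 1" if "\<bar>x - y\<bar> \<le> 1" for x y :: real
    using that by linarith
  show ?thesis unfolding based_homotopic_def
    using R c
    by (intro exI[of _ R] conjI exI[of _ "\<lambda>(s, t). wrap \<lfloor>\<Phi> s t\<rfloor>"])
      (auto simp: digital_continuous_def adj2_def adj1_def \<alpha> \<beta> ends wrap_eq_base_iff
        intro!: wrap_near fl step)
qed

lemma lipschitz_neighbours:
  fixes h :: "int \<Rightarrow> real"
  assumes step: "\<And>s. \<bar>h (s + 1) - h s\<bar> \<le> c" and "\<bar>s - s'\<bar> \<le> 1"
  shows "\<bar>h s - h s'\<bar> \<le> c"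
proof -
  consider "s = s'" | "s = s' + 1" | "s' = s + 1" using assms(2) by linarith
  then show ?thesis
  proof cases
    case 1
    then show ?thesis using order_trans[OF abs_ge_zero step[of s]] by simp
  next
    case 2
    then show ?thesis using step[of s'] by simp
  next
    case 3
    then show ?thesis using step[of s] by (simp add: abs_minus_commute)
  qed
qed

text \<open>
  The piecewise linear function whose value at \<open>k * b\<close> is \<open>f b\<close>.
\<close>

definition interpolate :: "(int \<Rightarrow> int) \<Rightarrow> int \<Rightarrow> int \<Rightarrow> real" where
  "interpolate f k s = f (s div k) + (s mod k) / k * (f (s div k + 1) - f (s div k))"

lemma interpolate_step:
  assumes "k \<ge> 1" and f: "\<And>b. \<bar>f (b + 1) - f b\<bar> \<le> 1"
  shows "\<bar>interpolate f k (s + 1) - interpolate f k s\<bar> \<le> 1 / k"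
proof -
  let ?d = "f (s div k + 1) - f (s div k)"
  have "interpolate f k (s + 1) - interpolate f k s = ?d / k"
    using div_step[OF assms(1), of s]
  proof (elim disjE conjE)
    assume "(s + 1) div k = s div k" "(s + 1) mod k = s mod k + 1"
    then show ?thesis
      by (simp add: interpolate_def add_divide_distrib diff_divide_distrib algebra_simps)
  next
    assume s: "(s + 1) div k = s div k + 1" "(s + 1) mod k = 0" "s mod k = k - 1"
    have "interpolate f k s = f (s div k) + (1 - 1 / real_of_int k) * ?d"
      unfolding interpolate_def s(3) using assms(1) by (simp add: diff_divide_distrib)
    moreover have "interpolate f k (s + 1) = f (s div k) + ?d"
      unfolding interpolate_def s(1,2) by simp
    moreover have "(1 - 1 / real_of_int k) * ?d = ?d - ?d / k"
      by (simp only: left_diff_distrib mult_1_left times_divide_eq_left)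
    ultimately show ?thesis by linarith
  qed
  moreover have "\<bar>real_of_int ?d\<bar> \<le> 1" using f[of "s div k"] by linarith
  ultimately show ?thesis using assms(1) by (simp add: divide_right_mono)
qed

text \<open>
  Staircase and interpolation can serve as consecutive rows of a homotopy. On a block of length \<open>k\<close> the
  interpolation moves from \<open>f b\<close> to \<open>f (b + 1)\<close>, reaching the latter only in the next block, so it stays
  within 1 of either value. The only other diagonal neighbour is the staircase value \<open>f (b - 1)\<close> next to
  the first point of block \<open>b\<close>, where the interpolation is exactly \<open>f b\<close>.
\<close>

lemma interpolate_near:
  assumes "k \<ge> 1" and f: "\<And>b. \<bar>f (b + 1) - f b\<bar> \<le> 1" and "\<bar>s - s'\<bar> \<le> 1"
  shows "\<bar>of_int (f (s div k)) - interpolate f k s'\<bar> \<le> 1"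
proof -
  let ?b = "s' div k" and ?r = "real_of_int (s' mod k) / k"
  have r: "0 \<le> ?r" "?r \<le> 1"
  proof -
    have "0 \<le> s' mod k" "s' mod k \<le> k"
      using assms(1) by (auto intro: less_imp_le pos_mod_bound)
    then show "0 \<le> ?r" "?r \<le> 1" using assms(1) by simp_all
  qed
  have d: "\<bar>real_of_int (f (?b + 1) - f ?b)\<bar> \<le> 1" using f[of ?b] by linarith
  consider "s div k = ?b" | "s div k = ?b + 1" | "?b = s div k + 1" "s' mod k = 0"
    using div_step[OF assms(1), of s] div_step[OF assms(1), of s'] assms(3)
    by (smt (verit))
  then show ?thesis
  proof cases
    case 1
    then have "of_int (f (s div k)) - interpolate f k s' = - (?r * real_of_int (f (?b + 1) - f ?b))"
      by (simp add: interpolate_def)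
    then have "\<bar>of_int (f (s div k)) - interpolate f k s'\<bar> = ?r * \<bar>real_of_int (f (?b + 1) - f ?b)\<bar>"
      using r(1) by (simp only: abs_minus_cancel abs_mult abs_of_nonneg)
    also have "\<dots> \<le> 1" using r d by (intro mult_le_one) auto
    finally show ?thesis .
  next
    case 2
    then have "of_int (f (s div k)) - interpolate f k s' = (1 - ?r) * real_of_int (f (?b + 1) - f ?b)"
      by (simp add: interpolate_def algebra_simps)
    then have "\<bar>of_int (f (s div k)) - interpolate f k s'\<bar> = (1 - ?r) * \<bar>real_of_int (f (?b + 1) - f ?b)\<bar>"
      using r(2) by (simp only: abs_mult abs_of_nonneg diff_ge_0_iff_ge)
    also have "\<dots> \<le> 1" using r d by (intro mult_le_one) auto
    finally show ?thesis .
  next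
    case 3
    then show ?thesis using f[of "s div k"] by (simp add: interpolate_def)
  qed
qed

lemma staircase_near:
  fixes k s s' :: int
  assumes "k \<ge> 1" and f: "\<And>b. \<bar>f (b + 1) - f b\<bar> \<le> (1::int)" and "\<bar>s - s'\<bar> \<le> 1"
  shows "\<bar>real_of_int (f (s div k)) - of_int (f (s' div k))\<bar> \<le> 1"
proof -
  have "\<bar>real_of_int (f ((s + 1) div k)) - of_int (f (s div k))\<bar> \<le> 1" for s
    using div_step[OF assms(1), of s]
  proof (elim disjE conjE)
    assume "(s + 1) div k = s div k + 1"
    then show ?thesis using f[of "s div k"] by simp
  qed simp
  then show ?thesis
    using assms(3) by (rule lipschitz_neighbours[where h = "\<lambda>s. of_int (f (s div k))"])
qed

text \<open>
  A homotopy in a single time step from the subdivided loop to the floor of its interpolated lift. The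
  lift is continued as a constant beyond \<open>M\<close>, because on the last block the interpolation refers to the
  value at \<open>M + 1\<close>; this makes it constant there, and so it ends where the lift ends.
\<close>

lemma smoothing_homotopic:
  fixes F :: "int \<Rightarrow> real"
  assumes \<gamma>: "(M, \<gamma>) \<in> diamond_loops" and "k \<ge> 1"
  defines "F \<equiv> interpolate (\<lambda>s. lift \<gamma> (min s M)) k" and "L \<equiv> k * M + k - 1"
  shows "based_homotopic diamond (vector [1, 0]) L (compose (Itv L) \<gamma> (rho k)) (\<lambda>s. wrap \<lfloor>F s\<rfloor>)"
    and "F 0 = 0" and "F L = lift \<gamma> M" and "\<And>s. \<bar>F (s + 1) - F s\<bar> \<le> 1 / k"
proof -
  let ?f = "\<lambda>s. lift \<gamma> (min s M)"
  note \<gamma>D = based_loopsD[OF \<gamma>]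
  have f: "\<bar>?f (b + 1) - ?f b\<bar> \<le> 1" for b
  proof -
    consider "b < 0" | "0 \<le> b" "b < M" | "M \<le> b" by linarith
    then show ?thesis
    proof cases
      case 1
      then have "min (b + 1) M \<le> 0" "min b M \<le> 0" by simp_all
      then show ?thesis by simp
    next
      case 2
      then have "min (b + 1) M = b + 1" "min b M = b" by simp_all
      moreover have "\<bar>turn (\<gamma> b) (\<gamma> (b + 1))\<bar> \<le> 1"
        using 2 by (intro turn_bounded \<gamma>D(4)) simp_all
      ultimately show ?thesis using lift_step[OF 2(1), of \<gamma>] by simp
    next
      case 3
      then have "min (b + 1) M = M" "min b M = M" by simp_all
      then show ?thesis by simp
    qed
  qed
  show F0: "F 0 = 0" using \<gamma>D(1) by (simp add: F_def interpolate_def)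
  show FL: "F L = lift \<gamma> M"
    using assms(2) by (simp add: F_def L_def interpolate_def div_last)
  show Fs: "\<bar>F (s + 1) - F s\<bar> \<le> 1 / k" for s
    unfolding F_def using assms(2) f by (rule interpolate_step[where f = ?f])
  have "1 / real_of_int k \<le> 1" using assms(2) by simp
  then have Fs1: "\<bar>F s - F s'\<bar> \<le> 1" if "\<bar>s - s'\<bar> \<le> 1" for s s'
    using lipschitz_neighbours[where h = F, OF Fs that] by linarith
  have near: "\<bar>of_int (?f (s div k)) - F s'\<bar> \<le> 1" if "\<bar>s - s'\<bar> \<le> 1" for s s'
    unfolding F_def using assms(2) f that by (rule interpolate_near[where f = ?f])
  have row: "\<bar>real_of_int (?f (s div k)) - of_int (?f (s' div k))\<bar> \<le> 1" if "\<bar>s - s'\<bar> \<le> 1" for s s'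
    using assms(2) f that by (rule staircase_near[where f = ?f])
  show "based_homotopic diamond (vector [1, 0]) L (compose (Itv L) \<gamma> (rho k)) (\<lambda>s. wrap \<lfloor>F s\<rfloor>)"
  proof (rule wrap_floor_homotopic
      [where R = 1 and c = "lift \<gamma> M" and \<Phi> = "\<lambda>s t. if t = 0 then of_int (?f (s div k)) else F s"])
    fix s s' t t' :: int assume ss': "\<bar>s - s'\<bar> \<le> 1"
    then have s's: "\<bar>s' - s\<bar> \<le> 1" by simp
    have "\<bar>F s - of_int (?f (s' div k))\<bar> \<le> 1"
      using near[OF s's] by (subst abs_minus_commute)
    with near[OF ss'] row[OF ss'] Fs1[OF ss']
    show "\<bar>(if t = 0 then of_int (?f (s div k)) else F s)
        - (if t' = 0 then of_int (?f (s' div k)) else F s')\<bar> \<le> 1"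
      by (cases "t = 0"; cases "t' = 0") (simp_all only: if_True if_False simp_thms)
  next
    show "4 dvd lift \<gamma> M" using degree_dvd[OF \<gamma>] by simp
  next
    fix s assume s: "s \<in> Itv L"
    note d = div_Itv[OF assms(2) s[unfolded L_def]]
    then have "?f (s div k) = lift \<gamma> (s div k)" by (simp add: min_absorb1)
    then show "compose (Itv L) \<gamma> (rho k) s
        = wrap \<lfloor>if (0::int) = 0 then of_int (?f (s div k)) else F s\<rfloor>"
      using s wrap_lift[OF \<gamma> d] by (simp add: compose_def rho_div)
  next
    have "?f (0 div k) = 0" "?f (L div k) = lift \<gamma> M"
      using \<gamma>D(1) div_last(1)[OF assms(2), of M] by (simp_all add: L_def)
    then show "(if t = 0 then of_int (?f (0 div k)) else F 0) = 0
        \<and> (if t = 0 then of_int (?f (L div k)) else F L) = of_int (lift \<gamma> M)" for t :: int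
      using F0 FL by (simp only: of_int_0 if_cancel simp_thms)
  qed simp_all
qed

text \<open>
  The permitted variation of 1 is shared equally between the two directions: a convex combination of
  \<open>F\<close> and \<open>G\<close> varies by at most \<open>1/2\<close> in space. Both functions start at 0, so their distance is at most
  \<open>L\<close>, and crossing it in \<open>2 * L\<close> time steps costs at most \<open>1/2\<close> per step.
\<close>

lemma straight_line_homotopic:
  fixes F G :: "int \<Rightarrow> real"
  assumes L: "1 \<le> L" and c: "4 dvd c"
    and F: "F 0 = 0" "F L = of_int c" "\<And>s. \<bar>F (s + 1) - F s\<bar> \<le> 1 / 2"
    and G: "G 0 = 0" "G L = of_int c" "\<And>s. \<bar>G (s + 1) - G s\<bar> \<le> 1 / 2"
  shows "based_homotopic diamond (vector [1, 0]) L (\<lambda>s. wrap \<lfloor>F s\<rfloor>) (\<lambda>s. wrap \<lfloor>G s\<rfloor>)"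
proof -
  let ?\<Phi> = "\<lambda>s t. F s + (real_of_int t / (2 * L)) * (G s - F s)"
  have gap: "\<bar>G s - F s\<bar> \<le> s" if "0 \<le> s" for s
    using that
  proof (induction s rule: int_ge_induct)
    case base
    then show ?case using F G by simp
  next
    case (step s)
    then show ?case using F(3)[of s] G(3)[of s] by (simp add: abs_if split: if_splits)
  qed
  have convex: "\<bar>(1 - l) * x + l * y\<bar> \<le> 1 / 2"
    if "0 \<le> l" "l \<le> 1" "\<bar>x\<bar> \<le> 1 / 2" "\<bar>y\<bar> \<le> 1 / 2" for l x y :: real
  proof -
    have "\<bar>(1 - l) * x + l * y\<bar> \<le> (1 - l) * \<bar>x\<bar> + l * \<bar>y\<bar>"
      using that(1,2) abs_triangle_ineq[of "(1 - l) * x" "l * y"] by (simp add: abs_mult)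
    also have "\<dots> \<le> (1 - l) * (1 / 2) + l * (1 / 2)"
      using that by (intro add_mono mult_left_mono) auto
    also have "\<dots> = 1 / 2" by (simp only: distrib_right [symmetric] diff_add_cancel mult_1_left)
    finally show ?thesis .
  qed
  have step: "\<bar>?\<Phi> s t - ?\<Phi> s' t'\<bar> \<le> 1"
    if st: "s \<in> Itv L" "s' \<in> Itv L" "t \<in> Itv (2 * L)" "\<bar>s - s'\<bar> \<le> 1" "\<bar>t - t'\<bar> \<le> 1" for s s' t t'
  proof -
    let ?l = "real_of_int t / (2 * L)" and ?l' = "real_of_int t' / (2 * L)"
    have l: "0 \<le> ?l" "?l \<le> 1" using st L by (auto simp: Itv_def)
    have "a + l * (b - a) - (a' + l * (b' - a')) = (1 - l) * (a - a') + l * (b - b')"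
      for a b a' b' l :: real by (simp add: algebra_simps)
    then have "\<bar>?\<Phi> s t - ?\<Phi> s' t\<bar> = \<bar>(1 - ?l) * (F s - F s') + ?l * (G s - G s')\<bar>"
      by (intro arg_cong[where f = abs])
    also have "\<dots> \<le> 1 / 2"
      using l lipschitz_neighbours[where h = F, OF F(3) st(4)]
        lipschitz_neighbours[where h = G, OF G(3) st(4)] by (rule convex)
    finally have 1: "\<bar>?\<Phi> s t - ?\<Phi> s' t\<bar> \<le> 1 / 2" .
    have "?\<Phi> s' t - ?\<Phi> s' t' = (real_of_int (t - t') / (2 * L)) * (G s' - F s')"
      by (simp add: field_simps diff_divide_distrib)
    then have "\<bar>?\<Phi> s' t - ?\<Phi> s' t'\<bar> = (\<bar>real_of_int (t - t')\<bar> / (2 * L)) * \<bar>G s' - F s'\<bar>"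
      using L by (simp add: abs_mult)
    also have "\<dots> \<le> (1 / (2 * L)) * L"
      using st L gap[of s'] by (intro mult_mono divide_right_mono) (auto simp: Itv_def)
    also have "\<dots> = 1 / 2" using L by simp
    finally show ?thesis using 1 by linarith
  qed
  show ?thesis
  proof (rule wrap_floor_homotopic[where R = "2 * L" and c = c and \<Phi> = ?\<Phi>])
    show "?\<Phi> 0 t = 0 \<and> ?\<Phi> L t = of_int c" for t
      using F(1,2) G(1,2) by simp
  qed (use L c step in simp_all)
qed

lemma subdivision_homotopic_diamond:
  "subdivision_homotopic diamond (vector [1, 0])
    = {(a, b). a \<in> diamond_loops \<and> b \<in> diamond_loops \<and> degree a = degree b}"
proof (intro equalityI subsetI)
  fix p assume "p \<in> subdivision_homotopic diamond (vector [1, 0])"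
  moreover obtain M \<alpha> N \<beta> where p: "p = ((M, \<alpha>), (N, \<beta>))"
    by (metis surj_pair)
  ultimately obtain k l where loops: "(M, \<alpha>) \<in> diamond_loops" "(N, \<beta>) \<in> diamond_loops"
    and kl: "k \<ge> 1" "l \<ge> 1" "k * (M + 1) = l * (N + 1)"
    and hom: "based_homotopic diamond (vector [1, 0]) (k * M + k - 1)
                 (compose (Itv (k * M + k - 1)) \<alpha> (rho k))
                 (compose (Itv (l * N + l - 1)) \<beta> (rho l))"
    unfolding subdivision_homotopic_def p mem_Collect_eq prod.case by blast
  have MN: "1 \<le> M" "1 \<le> N" using loops based_loopsD(1) by auto
  have len: "k * M + k - 1 = l * N + l - 1" using kl by (simp add: algebra_simps)
  have "0 \<le> k * M" using kl MN by simp
  then have "0 \<le> k * M + k - 1" using kl by linarith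
  from lift_homotopic[OF hom this]
  have "lift \<alpha> M = lift \<beta> N"
    using lift_compose_rho[of k M \<alpha>] lift_compose_rho[of l N \<beta>] kl MN len by simp
  then show "p \<in> {(a, b). a \<in> diamond_loops \<and> b \<in> diamond_loops \<and> degree a = degree b}"
    using p loops by simp
next
  fix p assume "p \<in> {(a, b). a \<in> diamond_loops \<and> b \<in> diamond_loops \<and> degree a = degree b}"
  moreover obtain M \<alpha> N \<beta> where p: "p = ((M, \<alpha>), (N, \<beta>))"
    by (metis surj_pair)
  ultimately have loops: "(M, \<alpha>) \<in> diamond_loops" "(N, \<beta>) \<in> diamond_loops"
    and eq: "lift \<alpha> M = lift \<beta> N"
    by simp_all
  have MN: "1 \<le> M" "1 \<le> N" using loops based_loopsD(1) by auto
  \<comment> \<open>Exchanging the two lengths gives a common length: \<open>k\<close> and \<open>l\<close> are at least 2 since loops have length at least 1.\<close>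
  define k l L where "k = N + 1" and "l = M + 1" and "L = k * M + k - 1"
  have kl: "k \<ge> 2" "l \<ge> 2" "k * (M + 1) = l * (N + 1)" and L': "L = l * N + l - 1"
    using MN by (auto simp: k_def l_def L_def algebra_simps)
  have "1 * 1 \<le> k * M" using kl MN by (intro mult_mono) auto
  then have L: "1 \<le> L" using kl by (simp add: L_def)
  define F where "F = interpolate (\<lambda>s. lift \<alpha> (min s M)) k"
  define G where "G = interpolate (\<lambda>s. lift \<beta> (min s N)) l"
  have k1: "k \<ge> 1" and l1: "l \<ge> 1" using kl by auto
  note \<alpha>F = smoothing_homotopic[OF loops(1) k1, folded F_def L_def]
  note \<beta>G = smoothing_homotopic[OF loops(2) l1, folded G_def L']
  have half: "1 / real_of_int k \<le> 1 / 2" "1 / real_of_int l \<le> 1 / 2"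
    using kl by (auto simp: field_simps)
  have "based_homotopic diamond (vector [1, 0]) L (\<lambda>s. wrap \<lfloor>F s\<rfloor>) (\<lambda>s. wrap \<lfloor>G s\<rfloor>)"
  proof (rule straight_line_homotopic[OF L, of "lift \<alpha> M"])
    show "4 dvd lift \<alpha> M" using degree_dvd[OF loops(1)] by simp
    show "\<bar>F (s + 1) - F s\<bar> \<le> 1 / 2" "\<bar>G (s + 1) - G s\<bar> \<le> 1 / 2" for s
      using \<alpha>F(4)[of s] \<beta>G(4)[of s] half by linarith+
  qed (use \<alpha>F \<beta>G eq in auto)
  then have "based_homotopic diamond (vector [1, 0]) L
      (compose (Itv L) \<alpha> (rho k)) (compose (Itv L) \<beta> (rho l))"
    by (rule based_homotopic_trans
        [OF \<alpha>F(1) based_homotopic_trans [OF _ based_homotopic_sym [OF \<beta>G(1)]]])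
  then have "based_homotopic diamond (vector [1, 0]) (k * M + k - 1)
      (compose (Itv (k * M + k - 1)) \<alpha> (rho k)) (compose (Itv (l * N + l - 1)) \<beta> (rho l))"
    by (simp only: L_def [symmetric] L' [symmetric])
  then have "\<exists>k\<ge>1. \<exists>l\<ge>1. k * (M + 1) = l * (N + 1)
      \<and> based_homotopic diamond (vector [1, 0]) (k * M + k - 1)
        (compose (Itv (k * M + k - 1)) \<alpha> (rho k)) (compose (Itv (l * N + l - 1)) \<beta> (rho l))"
    using kl(3) k1 l1 by (intro exI[of _ k] exI[of _ l] conjI)
  then show "p \<in> subdivision_homotopic diamond (vector [1, 0])"
    unfolding subdivision_homotopic_def p using loops by (simp only: mem_Collect_eq prod.case simp_thms)
qed

section \<open>The group of degrees\<close>

lemma loop_mult_based: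
  assumes "a \<in> based_loops Y y0" "b \<in> based_loops Y y0"
  shows "loop_mult a b \<in> based_loops Y y0"
proof -
  obtain M \<alpha> N \<beta> where ab: "a = (M, \<alpha>)" "b = (N, \<beta>)" by (cases a, cases b)
  note A = based_loopsD[OF assms(1)[unfolded ab]] and B = based_loopsD[OF assms(2)[unfolded ab]]
  let ?\<gamma> = "\<lambda>t\<in>Itv (M + N + 1). if t \<le> M then \<alpha> t else \<beta> (t - (M + 1))"
  have "adj (?\<gamma> s) (?\<gamma> t)" if st: "s \<in> Itv (M + N + 1)" "t \<in> Itv (M + N + 1)" "adj1 s t" for s t
  proof -
    have junction: "adj (\<alpha> s) (\<beta> (t - (M + 1)))"
      if "s \<in> Itv (M + N + 1)" "t \<in> Itv (M + N + 1)" "adj1 s t" "s \<le> M" "M < t" for s t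
    proof -
      have "s = M" "t = M + 1" using that by (auto simp: adj1_def)
      then show ?thesis using A B by simp
    qed
    show ?thesis using st A(5)[of s t] B(5)[of "s - (M + 1)" "t - (M + 1)"]
        junction[of s t] adj_sym[OF junction[of t s]]
      by (auto simp: Itv_def adj1_def abs_minus_commute)
  qed
  then show ?thesis using A B
    by (auto simp: ab based_loops_def digital_continuous_def Itv_def)
qed

lemma degree_mult:
  assumes "a \<in> diamond_loops" "b \<in> diamond_loops"
  shows "degree (loop_mult a b) = degree a + degree b"
proof -
  obtain M \<alpha> N \<beta> where ab: "a = (M, \<alpha>)" "b = (N, \<beta>)" by (cases a, cases b)
  note A = based_loopsD[OF assms(1)[unfolded ab]] and B = based_loopsD[OF assms(2)[unfolded ab]]
  let ?\<gamma> = "\<lambda>t\<in>Itv (M + N + 1). if t \<le> M then \<alpha> t else \<beta> (t - (M + 1))"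
  \<comment> \<open>The extra step from \<open>M\<close> to \<open>M + 1\<close> joins the base point to itself and has turn 0.\<close>
  have "lift ?\<gamma> (M + 1 + s) = lift \<alpha> M + lift \<beta> s" if "0 \<le> s" "s \<le> N" for s
    using that
  proof (induction s rule: int_ge_induct)
    case base
    have "lift ?\<gamma> M = lift \<alpha> M"
      using B(1) by (intro lift_cong) (auto simp: Itv_def)
    then show ?case using A B lift_step[of M ?\<gamma>] by (simp add: Itv_def del: restrict_apply) (simp)
  next
    case (step s)
    have "lift ?\<gamma> (M + 1 + s + 1) = lift ?\<gamma> (M + 1 + s) + turn (?\<gamma> (M + 1 + s)) (?\<gamma> (M + 1 + s + 1))"
      using step A(1) by (intro lift_step) simp
    also have "?\<gamma> (M + 1 + s) = \<beta> s" using step A(1) by (simp add: Itv_def)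
    also have "?\<gamma> (M + 1 + s + 1) = \<beta> (s + 1)" using step A(1) by (simp add: Itv_def add.commute)
    also have "lift ?\<gamma> (M + 1 + s) = lift \<alpha> M + lift \<beta> s"
      using step.prems by (intro step.IH) simp
    finally show ?case
      unfolding lift_step[OF step.hyps] by (simp only: add.assoc)
  qed
  from this[of N] B(1) show ?thesis by (simp add: ab algebra_simps)
qed

definition degree_class :: "int \<Rightarrow> 2 loop set" where
  "degree_class n = {a \<in> diamond_loops. degree a = 4 * n}"

lemma degree_class_nonempty: "degree_class n \<noteq> {}"
proof -
  \<comment> \<open>Going round \<open>\<bar>n\<bar>\<close> times at unit speed takes \<open>4 * \<bar>n\<bar>\<close> steps; the constant loop needs length 1.\<close>
  define N where "N = max 1 (4 * \<bar>n\<bar>)"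
  have N: "1 \<le> N" "sgn n * N = 4 * n"
    by (auto simp: N_def max_def sgn_if)
  let ?\<gamma> = "\<lambda>s\<in>Itv N. wrap (sgn n * s)"
  have near: "\<bar>sgn n * s - sgn n * t\<bar> \<le> 1" if "\<bar>s - t\<bar> \<le> 1" for s t
    using that by (auto simp: sgn_if)
  have "(N, ?\<gamma>) \<in> diamond_loops"
    using N by (auto simp: based_loops_def digital_continuous_def adj1_def wrap_eq_base_iff Itv_def
        intro!: wrap_near near)
  moreover have "degree (N, ?\<gamma>) = 4 * n"
  proof -
    have "lift ?\<gamma> N = lift (\<lambda>s. wrap (sgn n * s)) N"
      by (rule lift_cong) (simp add: Itv_def)
    also have "\<dots> = 4 * n"
      using N lift_wrap[of N "\<lambda>s. sgn n * s"] near by auto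
    finally show ?thesis by simp
  qed
  ultimately show ?thesis unfolding degree_class_def by blast
qed

lemma inj_degree_class: "inj degree_class"
proof (rule injI)
  fix m n assume eq: "degree_class m = degree_class n"
  obtain a where "a \<in> degree_class m" using degree_class_nonempty by blast
  then have "degree a = 4 * m" "degree a = 4 * n" using eq by (auto simp: degree_class_def)
  then show "m = n" by simp
qed

lemma loop_class_degree:
  assumes "a \<in> degree_class n"
  shows "loop_class diamond (vector [1, 0]) a = degree_class n"
  using assms by (auto simp: loop_class_def subdivision_homotopic_diamond degree_class_def)

lemma pi1_carrier: "carrier (digital_pi1 diamond (vector [1, 0])) = range degree_class"
proof -
  have "carrier (digital_pi1 diamond (vector [1, 0]))
      = loop_class diamond (vector [1, 0]) ` diamond_loops"
    by (auto simp: digital_pi1_def quotient_def loop_class_def)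
  also have "\<dots> = range degree_class"
  proof (intro equalityI subsetI)
    fix C assume "C \<in> loop_class diamond (vector [1, 0]) ` diamond_loops"
    then obtain a where a: "a \<in> diamond_loops" "C = loop_class diamond (vector [1, 0]) a"
      by blast
    obtain n where "degree a = 4 * n" using degree_dvd[OF a(1)] by (rule dvdE)
    then have "a \<in> degree_class n" using a(1) by (simp add: degree_class_def)
    then have "C = degree_class n" unfolding a(2) by (rule loop_class_degree)
    then show "C \<in> range degree_class" by blast
  next
    fix C assume "C \<in> range degree_class"
    then obtain n where n: "C = degree_class n" by blast
    obtain a where a: "a \<in> degree_class n" using degree_class_nonempty by blast
    then have "C = loop_class diamond (vector [1, 0]) a" unfolding n by (rule loop_class_degree [symmetric])
    moreover have "a \<in> diamond_loops" using a unfolding degree_class_def by blast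
    ultimately show "C \<in> loop_class diamond (vector [1, 0]) ` diamond_loops" by (rule image_eqI)
  qed
  finally show ?thesis .
qed

lemma pi1_mult:
  "degree_class m \<otimes>\<^bsub>digital_pi1 diamond (vector [1, 0])\<^esub> degree_class n = degree_class (m + n)"
proof -
  have "loop_class diamond (vector [1, 0]) (loop_mult a b) = degree_class (m + n)"
    if "a \<in> degree_class m" "b \<in> degree_class n" for a b
    using that by (intro loop_class_degree) (auto simp: degree_class_def loop_mult_based degree_mult)
  then show ?thesis
    using degree_class_nonempty[of m] degree_class_nonempty[of n]
    by (simp add: digital_pi1_def)
qed

lemma pi1_one: "\<one>\<^bsub>digital_pi1 diamond (vector [1, 0])\<^esub> = degree_class 0"
proof -
  have "lift (\<lambda>s\<in>Itv 1. vector [1, 0]) 1 = 0"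
    using lift_step[of 0 "\<lambda>s\<in>Itv 1. vector [1, 0]"] by (simp add: Itv_def)
  then have "(1, \<lambda>s\<in>Itv 1. vector [1, 0]) \<in> degree_class 0"
    by (auto simp: degree_class_def based_loops_def digital_continuous_def Itv_def diamond_def)
  then show ?thesis by (simp add: digital_pi1_def loop_class_degree)
qed

theorem theorem3p21:
  "group (digital_pi1 diamond (vector [1, 0])) \<and>
   digital_pi1 diamond (vector [1, 0]) \<cong> integer_group"
proof -
  let ?P = "digital_pi1 diamond (vector [1, 0])"
  have hom: "degree_class \<in> hom integer_group ?P"
    by (auto simp: hom_def pi1_carrier pi1_mult integer_group_def)
  \<comment> \<open>Associativity, unit and inverses are inherited from the integers: the image of a group
    homomorphism is a group, and here the image is everything.\<close>
  have "group (?P\<lparr>carrier := degree_class ` carrier integer_group, one := degree_class \<one>\<^bsub>integer_group\<^esub>\<rparr>)"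
    by (rule group.hom_imp_img_group[OF group_integer_group hom])
  moreover have "?P\<lparr>carrier := degree_class ` carrier integer_group,
      one := degree_class \<one>\<^bsub>integer_group\<^esub>\<rparr> = ?P"
    using pi1_carrier pi1_one by (simp add: integer_group_def)
  ultimately have "group ?P" by simp
  moreover have "degree_class \<in> iso integer_group ?P"
    using hom inj_degree_class by (auto simp: iso_def bij_betw_def pi1_carrier integer_group_def)
  then have "?P \<cong> integer_group"
    by (intro group.iso_sym[OF group_integer_group]) (auto simp: is_iso_def)
  ultimately show ?thesis by simp
qed

end
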